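(* Let $0<s\le1$ and consider the fully discrete scheme in $S_N$, for $0\le n\le M-1$, $$Y^{n,0}=U^n,\quad Y^{n,j}=Y^{n,j-1}+kb_jF\Big(\tfrac{Y^{n,j}+Y^{n,j-1}}2\Big)\ (1\le j\le q),\quad U^{n+1}=Y^{n,q},\qquad U^0=P_Nu_0.$$ Provided $U^n,Y^{n,j}\in S_N$, $1\le j\le q$, exist for $1\le n\le M$, it holds that $$\|U^n\|=\|U^0\|,\quad 0\le n\le M,$$ $$\mathrm{Im}(U^n,U^n_x)=\mathrm{Im}(U^0,U^0_x),\quad 0\le n\le M.$$
   Context: $u_0$ is smooth and $2\pi$-periodic. Functions are complex-valued and $2\pi$-periodic; $(u_1,u_2)=\int_{-\pi}^{\pi}u_1\overline{u_2}\,dx$ with induced norm $\|\cdot\|$. $\widehat u(k)=\frac1{2\pi}\int_{-\pi}^{\pi}u(x)e^{-ikx}dx$; $(-\partial_{xx})^s$ has Fourier symbol $|k|^{2s}$. $N\ge1$ is an integer, $S_N=\mathrm{span}\{e^{ikx}:-N\le k\le N\}$, $P_Nu=\sum_{|k|\le N}\widehat u(k)e^{ikx}$, and $F:S_N\to S_N$, $F(u)=-i(-\partial_{xx})^su+iP_N(|u|^2u)$. $k>0$ is the time step and $M$ an integer with $T=Mk$. For $p\ge1$ the method has $q=3^{p-1}$ stages with nonzero real coefficients $b_1,\dots,b_q$ of Yoshida's triple-jump composition: for $p=1$, $b_1=1$; if $b=(b_1,\dots,b_q)$ is the vector for $p$, the one for $p+1$ is the concatenation $(\gamma b,(1-2\gamma)b,\gamma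 b)$ with $\gamma=1/(2-2^{1/(2p+1)})$. *)

theory Defs
  imports "HOL-Analysis.Analysis"
begin

definition smooth :: "(real \<Rightarrow> complex) \<Rightarrow> bool" where
  "smooth u \<longleftrightarrow>
     (\<exists>D. D 0 = u \<and> (\<forall>n x. (D n has_vector_derivative D (Suc n) x) (at x)))"

definition dx :: "(real \<Rightarrow> complex) \<Rightarrow> real \<Rightarrow> complex" where
  "dx u x = vector_derivative u (at x)"

definition l2_inner :: "(real \<Rightarrow> complex) \<Rightarrow> (real \<Rightarrow> complex) \<Rightarrow> complex" where
  "l2_inner u v = integral {-pi..pi} (\<lambda>x. u x * cnj (v x))"

definition l2_norm :: "(real \<Rightarrow> complex) \<Rightarrow> real" where
  "l2_norm u = sqrt (Re (l2_inner u u))"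

definition fourier_mode :: "int \<Rightarrow> real \<Rightarrow> complex" where
  "fourier_mode m x = exp (\<i> * of_int m * of_real x)"

definition fourier_coeff :: "(real \<Rightarrow> complex) \<Rightarrow> int \<Rightarrow> complex" where
  "fourier_coeff u m =
     1 / (2 * of_real pi) * integral {-pi..pi} (\<lambda>x. u x * exp (- \<i> * of_int m * of_real x))"

(* The complex span of the modes with index between -N and N, written out because functions
   real => complex do not form an instance of a complex vector space class. *)
definition trig_space :: "nat \<Rightarrow> (real \<Rightarrow> complex) set" where
  "trig_space N = {u. \<exists>c. u = (\<lambda>x. \<Sum>m = - int N..int N. c m * fourier_mode m x)}"

definition fourier_proj :: "nat \<Rightarrow> (real \<Rightarrow> complex) \<Rightarrow> real \<Rightarrow> complex" where
  "fourier_proj N u x = (\<Sum>m = - int N..int N. fourier_coeff u m * fourier_mode m x)"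

(* The operator with Fourier symbol |m|^(2s); the mode m = 0 gets the factor 0 powr (2 s) = 0.
   On a trigonometric polynomial only finitely many terms are nonzero. *)
definition frac_laplacian :: "real \<Rightarrow> (real \<Rightarrow> complex) \<Rightarrow> real \<Rightarrow> complex" where
  "frac_laplacian s u x =
     (\<Sum>\<^sub>\<infinity>m\<in>UNIV. of_real (of_int \<bar>m\<bar> powr (2 * s)) * fourier_coeff u m * fourier_mode m x)"

definition nls_rhs :: "real \<Rightarrow> nat \<Rightarrow> (real \<Rightarrow> complex) \<Rightarrow> real \<Rightarrow> complex" where
  "nls_rhs s N u x =
     - \<i> * frac_laplacian s u x + \<i> * fourier_proj N (\<lambda>y. of_real ((cmod (u y))\<^sup>2) * u y) x"

definition triple_jump_gamma :: "nat \<Rightarrow> real" where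
  "triple_jump_gamma p = 1 / (2 - 2 powr (1 / (2 * real p + 1)))"

(* The recursion starts at p = 1; the value at 0 is a dummy. The list is indexed from 0, so the
   coefficient b_j is triple_jump p ! (j - 1). *)
fun triple_jump :: "nat \<Rightarrow> real list" where
  "triple_jump 0 = []"
| "triple_jump (Suc 0) = [1]"
| "triple_jump (Suc (Suc p)) =
     (let \<gamma> = triple_jump_gamma (Suc p); b = triple_jump (Suc p)
      in map ((*) \<gamma>) b @ map ((*) (1 - 2 * \<gamma>)) b @ map ((*) \<gamma>) b)"

lemma length_triple_jump: "p \<ge> 1 \<Longrightarrow> length (triple_jump p) = 3 ^ (p - 1)"
  by (induction p rule: triple_jump.induct) (auto simp: Let_def)

lemma triple_jump_gamma_gt_1: 
  assumes "p \<ge> 1"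
  shows "triple_jump_gamma p > 1"
proof -
  have "(2::real) powr 0 < 2 powr (1 / (2 * real p + 1))"
    by (intro powr_less_mono) auto
  moreover have "(2::real) powr (1 / (2 * real p + 1)) < 2 powr 1"
    using assms by (intro powr_less_mono) (auto simp: field_simps)
  ultimately show ?thesis
    by (simp add: triple_jump_gamma_def field_simps)
qed

lemma triple_jump_nonzero: "0 \<notin> set (triple_jump p)"
proof (induction p rule: triple_jump.induct)
  case (3 p)
  then show ?case
    using triple_jump_gamma_gt_1[of "Suc p"] by (auto simp: Let_def)
qed auto

end

theory Submission
  imports Defs
begin

text \<open>
  On trigonometric polynomials both invariants are, up to a constant, weighted sums
  \<open>\<Sum>m. \<kappa> m * \<bar>a m\<bar>\<^sup>2\<close> of Fourier coefficients with real weights: \<open>\<kappa> m = 1\<close> gives the mass and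
  \<open>\<kappa> m = m\<close> the momentum. Along one midpoint stage with midpoint \<open>w\<close> such a sum changes by a
  multiple of \<open>Re (\<Sum>m. \<kappa> m * F(w) m * cnj (w m))\<close>. The dispersive term drops out since its symbol is
  real; the projection \<open>P_N\<close> can be dropped when testing against \<open>w\<close> or \<open>w_x\<close>, and then the cubic
  term contributes \<open>Im \<integral>\<bar>w\<bar>\<^sup>4 = 0\<close> for the mass and
  \<open>Re \<integral>\<bar>w\<bar>\<^sup>2 w cnj w_x = (1/4) \<integral>(\<bar>w\<bar>\<^sup>4)_x = 0\<close> for the momentum.
\<close>

section \<open>Trigonometric polynomials and their Fourier coefficients\<close>

definition trig_poly :: "nat \<Rightarrow> (int \<Rightarrow> complex) \<Rightarrow> real \<Rightarrow> complex" where
  "trig_poly N c x = (\<Sum>m = - int N..int N. c m * fourier_mode m x)"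

lemma trig_space_iff: "u \<in> trig_space N \<longleftrightarrow> (\<exists>c. u = trig_poly N c)"
  by (auto simp: trig_space_def trig_poly_def[abs_def])

lemma fourier_proj_eq: "fourier_proj N u = trig_poly N (fourier_coeff u)"
  by (simp add: fun_eq_iff fourier_proj_def trig_poly_def)

lemma fourier_mode_has_vector_derivative:
  "(fourier_mode m has_vector_derivative (\<i> * of_int m * fourier_mode m x)) (at x within S)"
proof -
  have "((\<lambda>z. exp (\<i> * of_int m * z)) has_field_derivative
          (\<i> * of_int m * exp (\<i> * of_int m * of_real x))) (at (of_real x))"
    by (auto intro!: derivative_eq_intros)
  then have "((\<lambda>x. exp (\<i> * of_int m * of_real x)) has_vector_derivative
          (\<i> * of_int m * exp (\<i> * of_int m * of_real x))) (at x)"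
    by (rule has_vector_derivative_real_field)
  then show ?thesis
    unfolding fourier_mode_def[abs_def] by (rule has_vector_derivative_at_within)
qed

lemma continuous_on_fourier_mode [continuous_intros]: "continuous_on S (fourier_mode m)"
  unfolding fourier_mode_def[abs_def] by (intro continuous_intros)

lemma continuous_on_trig_poly [continuous_intros]: "continuous_on S (trig_poly N c)"
  unfolding trig_poly_def[abs_def] by (intro continuous_intros)

lemma fourier_mode_mult_cnj: "fourier_mode m x * cnj (fourier_mode n x) = fourier_mode (m - n) x"
  by (simp add: fourier_mode_def exp_cnj flip: exp_add) (simp add: algebra_simps)

lemma cnj_fourier_mode: "cnj (fourier_mode m x) = exp (- \<i> * of_int m * of_real x)"
  by (simp add: fourier_mode_def exp_cnj)

lemma fourier_mode_periodic: "fourier_mode m (- pi) = fourier_mode m pi"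
  \<comment> \<open>The exponents at -pi and pi differ by 2 * (- m) * pi * \<i>, hence the
    witness.\<close>
  unfolding fourier_mode_def exp_eq by (rule exI[of _ "- m"]) (simp add: algebra_simps)

lemma trig_poly_periodic: "trig_poly N c (- pi) = trig_poly N c pi"
  by (simp add: trig_poly_def fourier_mode_periodic)

text \<open>For m \<noteq> 0 the mode is, up to the factor \<open>\<i> * of_int m\<close>, the
  derivative of a periodic function. Together with \<open>fourier_mode_mult_cnj\<close> this yields
  orthogonality of the modes.\<close>

lemma integral_fourier_mode:
  "integral {-pi..pi} (fourier_mode m) = (if m = 0 then 2 * of_real pi else 0)"
proof (cases "m = 0")
  case True
  then have "fourier_mode m = (\<lambda>_. 1)"
    by (simp add: fourier_mode_def fun_eq_iff)
  then show ?thesis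
    using True by (simp add: scaleR_conv_of_real)
next
  case False
  have "((\<lambda>x. \<i> * of_int m * fourier_mode m x) has_integral
          (fourier_mode m pi - fourier_mode m (- pi))) {-pi..pi}"
    by (intro fundamental_theorem_of_calculus fourier_mode_has_vector_derivative) simp
  then have "integral {-pi..pi} (\<lambda>x. \<i> * of_int m * fourier_mode m x) = 0"
    by (simp only: fourier_mode_periodic diff_self integral_unique)
  then show ?thesis
    using False by (simp add: integral_mult_right)
qed

text \<open>This is how the projection is dropped: a test function in the trigonometric space sees
  only the coefficients of \<open>f\<close> with index up to N in modulus, so the cubic term can be
  paired with it without projecting first.\<close>

lemma l2_inner_trig_poly_right:
  assumes "continuous_on {-pi..pi} f"
  shows "l2_inner f (trig_poly N d) =
           2 * of_real pi * (\<Sum>m = - int N..int N. fourier_coeff f m * cnj (d m))"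
proof -
  have int: "(\<lambda>x. f x * cnj (fourier_mode m x)) integrable_on {-pi..pi}" for m
    by (intro integrable_continuous_real continuous_intros assms)
  have "l2_inner f (trig_poly N d) =
          integral {-pi..pi} (\<lambda>x. \<Sum>m = - int N..int N. cnj (d m) * (f x * cnj (fourier_mode m x)))"
    by (simp add: l2_inner_def trig_poly_def sum_distrib_left mult_ac)
  also have "\<dots> = (\<Sum>m = - int N..int N.
      cnj (d m) * integral {-pi..pi} (\<lambda>x. f x * cnj (fourier_mode m x)))"
    by (subst integral_sum) (auto intro!: integrable_on_mult_right int)
  finally show ?thesis
    by (simp add: fourier_coeff_def cnj_fourier_mode sum_distrib_left mult_ac)
qed

lemma fourier_coeff_trig_poly:
  "fourier_coeff (trig_poly N c) m = (if m \<in> {- int N..int N} then c m else 0)"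
proof -
  have int: "(\<lambda>x. c j * fourier_mode (j - m) x) integrable_on {-pi..pi}" for j
    by (intro integrable_continuous_real continuous_intros)
  have "fourier_coeff (trig_poly N c) m = 1 / (2 * of_real pi) *
      integral {-pi..pi} (\<lambda>x. trig_poly N c x * cnj (fourier_mode m x))"
    by (simp add: fourier_coeff_def cnj_fourier_mode)
  also have "(\<lambda>x. trig_poly N c x * cnj (fourier_mode m x)) =
      (\<lambda>x. \<Sum>j = - int N..int N. c j * fourier_mode (j - m) x)"
    by (simp add: trig_poly_def sum_distrib_right mult.assoc fourier_mode_mult_cnj)
  also have "integral {-pi..pi} \<dots> = (\<Sum>j = - int N..int N. c j * (if j = m then 2 * of_real pi else 0))"
    by (subst integral_sum) (auto intro!: int sum.cong simp: integral_fourier_mode)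
  also have "\<dots> = (\<Sum>j = - int N..int N. if j = m then c m * (2 * of_real pi) else 0)"
    by (intro sum.cong) auto
  finally show ?thesis
    by (simp add: sum.delta)
qed

lemma trig_poly_add_cmult:
  "trig_poly N (\<lambda>m. c m + z * d m) = (\<lambda>x. trig_poly N c x + z * trig_poly N d x)"
  by (simp add: trig_poly_def fun_eq_iff sum.distrib sum_distrib_left algebra_simps)

text \<open>Used to read the stage equation, an identity between functions, mode by mode.\<close>

lemma trig_poly_eqD:
  assumes "trig_poly N c = trig_poly N d" "m \<in> {- int N..int N}"
  shows "c m = d m"
  using assms fourier_coeff_trig_poly[of N c m] fourier_coeff_trig_poly[of N d m] by simp

lemma l2_inner_trig_poly:
  "l2_inner (trig_poly N c) (trig_poly N d) =
     2 * of_real pi * (\<Sum>m = - int N..int N. c m * cnj (d m))"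
  by (simp add: l2_inner_trig_poly_right continuous_on_trig_poly fourier_coeff_trig_poly)

lemma trig_poly_has_vector_derivative:
  "(trig_poly N c has_vector_derivative trig_poly N (\<lambda>m. \<i> * of_int m * c m) x) (at x within S)"
proof -
  have "((\<lambda>x. \<Sum>m = - int N..int N. c m * fourier_mode m x) has_vector_derivative
      (\<Sum>m = - int N..int N. c m * (\<i> * of_int m * fourier_mode m x))) (at x within S)"
    by (intro has_vector_derivative_sum has_vector_derivative_mult_right
        fourier_mode_has_vector_derivative)
  then show ?thesis
    by (simp add: trig_poly_def[abs_def] mult_ac)
qed

lemma dx_trig_poly: "dx (trig_poly N c) = trig_poly N (\<lambda>m. \<i> * of_int m * c m)"
  using trig_poly_has_vector_derivative
  by (simp add: fun_eq_iff dx_def vector_derivative_at)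

lemma frac_laplacian_trig_poly:
  "frac_laplacian s (trig_poly N c) = trig_poly N (\<lambda>m. of_real (of_int \<bar>m\<bar> powr (2 * s)) * c m)"
proof
  fix x
  \<comment> \<open>The coefficients outside -N..N vanish, so the infinite sum reduces to a finite
    one.\<close>
  have "frac_laplacian s (trig_poly N c) x =
      (\<Sum>\<^sub>\<infinity>m\<in>{- int N..int N}. of_real (of_int \<bar>m\<bar> powr (2 * s)) * c m * fourier_mode m x)"
    unfolding frac_laplacian_def
    by (intro infsum_cong_neutral) (auto simp: fourier_coeff_trig_poly)
  then show "frac_laplacian s (trig_poly N c) x =
      trig_poly N (\<lambda>m. of_real (of_int \<bar>m\<bar> powr (2 * s)) * c m) x"
    by (simp add: trig_poly_def)
qed

section \<open>The right-hand side and the cancellations in its cubic term\<close>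

abbreviation cubic :: "(real \<Rightarrow> complex) \<Rightarrow> real \<Rightarrow> complex" where
  "cubic u \<equiv> \<lambda>x. of_real ((cmod (u x))\<^sup>2) * u x"

lemma nls_rhs_trig_poly:
  "nls_rhs s N (trig_poly N w) = trig_poly N (\<lambda>m. \<i> *
     (fourier_coeff (cubic (trig_poly N w)) m - of_real (of_int \<bar>m\<bar> powr (2 * s)) * w m))"
  by (simp add: fun_eq_iff nls_rhs_def frac_laplacian_trig_poly fourier_proj_eq)
    (simp add: trig_poly_def sum_distrib_left sum_subtractf algebra_simps)

lemma continuous_on_cubic_trig_poly: "continuous_on S (cubic (trig_poly N w))"
  by (intro continuous_intros)

text \<open>Up to the factor 2 * pi the sum is the pairing of the cubic term with the polynomial
  itself, whose integrand is the real function \<bar>w\<bar>^4.\<close>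

lemma cubic_mass:
  "Im (\<Sum>m = - int N..int N. fourier_coeff (cubic (trig_poly N w)) m * cnj (w m)) = 0"
proof -
  have "l2_inner (cubic (trig_poly N w)) (trig_poly N w) =
      integral {-pi..pi} (\<lambda>x. of_real (cmod (trig_poly N w x) ^ 4))"
    unfolding l2_inner_def mult.assoc complex_norm_square[symmetric]
    by (simp flip: power_add)
  also have "\<dots> = of_real (integral {-pi..pi} (\<lambda>x. cmod (trig_poly N w x) ^ 4))"
    by (intro integral_unique has_integral_of_real integrable_integral
        integrable_continuous_real continuous_intros)
  finally have "Im (l2_inner (cubic (trig_poly N w)) (trig_poly N w)) = 0"
    by (simp only: Im_complex_of_real)
  then show ?thesis
    unfolding l2_inner_trig_poly_right[OF continuous_on_cubic_trig_poly]
    by (simp del: Im_sum)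
qed

lemma cubic_momentum:
  "Im (\<Sum>m = - int N..int N. of_int m * fourier_coeff (cubic (trig_poly N w)) m * cnj (w m)) = 0"
proof -
  let ?u = "trig_poly N w" and ?v = "trig_poly N (\<lambda>m. \<i> * of_int m * w m)"
  \<comment> \<open>Here \<open>?v\<close> is the derivative of \<open>?u\<close>, and the real
    inner product \<open>?u x \<bullet> ?u x\<close> is the squared modulus, so the function
    differentiated is \<bar>u\<bar>^4. One factor 2 comes from the outer square, the other from the
    symmetry of the inner product.\<close>
  have deriv: "((\<lambda>x. (?u x \<bullet> ?u x)\<^sup>2) has_vector_derivative
      4 * Re (cubic ?u x * cnj (?v x))) (at x within S)" for x S
  proof -
    have "((\<lambda>x. ?u x \<bullet> ?u x) has_vector_derivative (?u x \<bullet> ?v x + ?v x \<bullet> ?u x)) (at x within S)"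
      by (rule bounded_bilinear.has_vector_derivative[OF bounded_bilinear_inner])
        (rule trig_poly_has_vector_derivative)+
    then have "((\<lambda>x. ?u x \<bullet> ?u x) has_real_derivative (2 * (?u x \<bullet> ?v x))) (at x within S)"
      by (simp add: has_real_derivative_iff_has_vector_derivative inner_commute)
    then have "((\<lambda>x. (?u x \<bullet> ?u x)\<^sup>2) has_real_derivative
        4 * ((?u x \<bullet> ?u x) * (?u x \<bullet> ?v x))) (at x within S)"
      by (auto intro!: derivative_eq_intros)
    moreover have "(?u x \<bullet> ?u x) * (?u x \<bullet> ?v x) = Re (cubic ?u x * cnj (?v x))"
      by (simp add: dot_square_norm del: of_real_power)
        (simp add: inner_complex_def algebra_simps del: of_real_power)
    ultimately show ?thesis
      by (simp only: has_real_derivative_iff_has_vector_derivative)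
  qed
  have "((\<lambda>x. 4 * Re (cubic ?u x * cnj (?v x))) has_integral
      (?u pi \<bullet> ?u pi)\<^sup>2 - (?u (- pi) \<bullet> ?u (- pi))\<^sup>2) {-pi..pi}"
    by (intro fundamental_theorem_of_calculus deriv) simp
  then have "integral {-pi..pi} (\<lambda>x. 4 * Re (cubic ?u x * cnj (?v x))) = 0"
    by (simp only: trig_poly_periodic diff_self integral_unique)
  then have "integral {-pi..pi} (\<lambda>x. Re (cubic ?u x * cnj (?v x))) = 0"
    by (simp only: integral_mult_right)
  moreover have int: "(\<lambda>x. cubic ?u x * cnj (?v x)) integrable_on {-pi..pi}"
    by (intro integrable_continuous_real continuous_intros)
  ultimately have "Re (l2_inner (cubic ?u) ?v) = 0"
    unfolding l2_inner_def
    using integral_unique[OF has_integral_Re[OF integrable_integral[OF int]]] by simp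
  \<comment> \<open>Conjugating \<open>\<i>\<close> pulls out the factor \<open>- \<i>\<close>, and
    Re (- \<i> * z) = Im z: the vanishing real part of the pairing becomes the vanishing imaginary
    part of the weighted sum.\<close>
  moreover have "(\<Sum>m = - int N..int N. fourier_coeff (cubic ?u) m * cnj (\<i> * of_int m * w m)) =
      - \<i> * (\<Sum>m = - int N..int N. of_int m * fourier_coeff (cubic ?u) m * cnj (w m))"
    by (simp add: sum_distrib_left mult_ac)
  ultimately show ?thesis
    unfolding l2_inner_trig_poly_right[OF continuous_on_cubic_trig_poly]
    by (simp del: Re_sum Im_sum complex_cnj_mult)
qed

section \<open>Mass and momentum in Fourier coefficients, and their change along a midpoint
  stage\<close>

lemma l2_norm_trig_poly:
  "l2_norm (trig_poly N a) = sqrt (2 * pi * (\<Sum>m = - int N..int N. (cmod (a m))\<^sup>2))"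
  by (simp add: l2_norm_def l2_inner_trig_poly flip: complex_norm_square of_real_sum)

lemma momentum_trig_poly:
  "Im (l2_inner (trig_poly N a) (dx (trig_poly N a))) =
     - 2 * pi * (\<Sum>m = - int N..int N. of_int m * (cmod (a m))\<^sup>2)"
proof -
  have "(\<Sum>m = - int N..int N. a m * cnj (\<i> * of_int m * a m)) =
      - \<i> * of_real (\<Sum>m = - int N..int N. of_int m * (cmod (a m))\<^sup>2)"
    by (simp add: sum_distrib_left complex_norm_square mult_ac del: of_real_power)
  then show ?thesis
    by (simp add: dx_trig_poly l2_inner_trig_poly del: complex_cnj_mult)
qed

text \<open>Both invariants at once, for arbitrary real weights \<open>\<kappa>\<close>; the
  nonlinearity enters only through the cancellation \<open>g\<close>. The step \<open>h\<close> may
  have either sign, as triple-jump coefficients can be negative.\<close>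

lemma weighted_sum_midpoint_step:
  fixes \<kappa> \<omega> :: "int \<Rightarrow> real" and a b w g :: "int \<Rightarrow> complex" and h :: real
  assumes step: "\<And>m. m \<in> A \<Longrightarrow> b m = a m + of_real h * (\<i> * (g m - of_real (\<omega> m) * w m))"
    and mid: "\<And>m. m \<in> A \<Longrightarrow> w m = (b m + a m) / 2"
    and g: "Im (\<Sum>m\<in>A. of_real (\<kappa> m) * g m * cnj (w m)) = 0"
  shows "(\<Sum>m\<in>A. \<kappa> m * (cmod (b m))\<^sup>2) = (\<Sum>m\<in>A. \<kappa> m * (cmod (a m))\<^sup>2)"
proof -
  have "\<kappa> m * (cmod (b m))\<^sup>2 - \<kappa> m * (cmod (a m))\<^sup>2 =
      - 2 * h * Im (of_real (\<kappa> m) * g m * cnj (w m))" if m: "m \<in> A" for m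
  proof -
    \<comment> \<open>The right side is Re ((b - a) * cnj (b + a)), whose cross terms are purely
      imaginary. This is where the midpoint is essential.\<close>
    have "(cmod (b m))\<^sup>2 - (cmod (a m))\<^sup>2 = 2 * Re ((b m - a m) * cnj (w m))"
      unfolding mid[OF m] cmod_power2 by (simp add: field_simps power2_eq_square)
    also have "b m - a m = of_real h * (\<i> * (g m - of_real (\<omega> m) * w m))"
      using step[OF m] by simp
    \<comment> \<open>The dispersive part is \<open>\<i>\<close> times a real multiple of
      \<bar>w\<bar>^2 and has no real part; the rest is Re (\<i> * z) = - Im z.\<close>
    also have "2 * Re (\<dots> * cnj (w m)) = - 2 * h * Im (g m * cnj (w m))"
      by (simp add: algebra_simps)
    finally have "\<kappa> m * ((cmod (b m))\<^sup>2 - (cmod (a m))\<^sup>2) =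
        \<kappa> m * (- 2 * h * Im (g m * cnj (w m)))"
      by (rule arg_cong)
    then show ?thesis
      by (simp add: algebra_simps)
  qed
  then have "(\<Sum>m\<in>A. \<kappa> m * (cmod (b m))\<^sup>2 - \<kappa> m * (cmod (a m))\<^sup>2) =
      - 2 * h * Im (\<Sum>m\<in>A. of_real (\<kappa> m) * g m * cnj (w m))"
    by (simp add: sum_distrib_left)
  then show ?thesis
    using g by (simp add: sum_subtractf)
qed

lemma midpoint_stage_invariants:
  fixes h :: real
  assumes "u \<in> trig_space N" "v \<in> trig_space N"
    and v: "v = (\<lambda>x. u x + of_real h * nls_rhs s N (\<lambda>y. (v y + u y) / 2) x)"
  shows "l2_norm v = l2_norm u"
    and "Im (l2_inner v (dx v)) = Im (l2_inner u (dx u))"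
proof -
  obtain a b where a: "u = trig_poly N a" and b: "v = trig_poly N b"
    using assms(1,2) by (auto simp: trig_space_iff)
  define w where "w = (\<lambda>m. (b m + a m) / 2)"
  define g where "g = fourier_coeff (cubic (trig_poly N w))"
  have "(\<lambda>y. (v y + u y) / 2) = trig_poly N w"
    by (simp add: a b w_def trig_poly_def fun_eq_iff sum_divide_distrib field_simps
        flip: sum.distrib)
  from v[unfolded this]
  have "trig_poly N b = (\<lambda>x. trig_poly N a x + of_real h * nls_rhs s N (trig_poly N w) x)"
    unfolding a b .
  also have "\<dots> = trig_poly N
      (\<lambda>m. a m + of_real h * (\<i> * (g m - of_real (of_int \<bar>m\<bar> powr (2 * s)) * w m)))"
    by (simp only: nls_rhs_trig_poly trig_poly_add_cmult g_def)
  finally have "trig_poly N b = \<dots>" .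
  note step = trig_poly_eqD[OF this]
  \<comment> \<open>The explicit factor 1 makes the sum match the weighted form with constant weight
    \<open>\<kappa>\<close>.\<close>
  have "(\<Sum>m = - int N..int N. 1 * (cmod (b m))\<^sup>2) = (\<Sum>m = - int N..int N. 1 * (cmod (a m))\<^sup>2)"
    by (rule weighted_sum_midpoint_step[OF step])
      (use cubic_mass[of N w] in \<open>simp_all add: w_def g_def\<close>)
  then show "l2_norm v = l2_norm u"
    by (simp add: a b l2_norm_trig_poly)
  have "(\<Sum>m = - int N..int N. of_int m * (cmod (b m))\<^sup>2) =
      (\<Sum>m = - int N..int N. of_int m * (cmod (a m))\<^sup>2)"
    by (rule weighted_sum_midpoint_step[OF step])
      (use cubic_momentum[of N w] in \<open>simp_all add: w_def g_def\<close>)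
  then show "Im (l2_inner v (dx v)) = Im (l2_inner u (dx u))"
    by (simp add: a b momentum_trig_poly)
qed

section \<open>Composition of the stages over all time steps\<close>

theorem lemma3p1:
  fixes s k T :: real and N M p q :: nat
    and u0 :: "real \<Rightarrow> complex"
    and U :: "nat \<Rightarrow> real \<Rightarrow> complex"
    and Y :: "nat \<Rightarrow> nat \<Rightarrow> real \<Rightarrow> complex"
  assumes "0 < s" and "s \<le> 1"
    and "N \<ge> 1"
    and "k > 0" and "T = real M * k"
    and "p \<ge> 1" and "q = 3 ^ (p - 1)"
    and "smooth u0" and "periodic_fun_simple u0 (2 * pi)"
    and "U 0 = fourier_proj N u0"
    and "\<And>n. 1 \<le> n \<Longrightarrow> n \<le> M \<Longrightarrow> U n \<in> trig_space N"
    and "\<And>n j. n < M \<Longrightarrow> 1 \<le> j \<Longrightarrow> j \<le> q \<Longrightarrow> Y n j \<in> trig_space N"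
    and "\<And>n. n < M \<Longrightarrow> Y n 0 = U n"
    and "\<And>n j. n < M \<Longrightarrow> 1 \<le> j \<Longrightarrow> j \<le> q \<Longrightarrow>
           Y n j = (\<lambda>x. Y n (j - 1) x
             + of_real (k * triple_jump p ! (j - 1))
               * nls_rhs s N (\<lambda>y. (Y n j y + Y n (j - 1) y) / 2) x)"
    and "\<And>n. n < M \<Longrightarrow> U (Suc n) = Y n q"
  shows "(\<forall>n\<le>M. l2_norm (U n) = l2_norm (U 0)) \<and>
         (\<forall>n\<le>M. Im (l2_inner (U n) (dx (U n))) = Im (l2_inner (U 0) (dx (U 0))))"
proof -
  \<comment> \<open>Membership at n = 0 comes from the projection of the initial datum, since the
    existence hypothesis starts at n = 1. Likewise stage 0 below inherits it from
    \<open>U n\<close>.\<close>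
  have U_in: "U n \<in> trig_space N" if "n \<le> M" for n
    using assms(10,11) that by (cases "n = 0") (auto simp: fourier_proj_eq trig_space_iff)
  have Y_in: "Y n j \<in> trig_space N" if "n < M" "j \<le> q" for n j
    using assms(12)[of n j] assms(13)[of n] U_in[of n] that by (cases "j = 0") auto
  have Y_inv: "l2_norm (Y n j) = l2_norm (U n) \<and>
      Im (l2_inner (Y n j) (dx (Y n j))) = Im (l2_inner (U n) (dx (U n)))"
    if "n < M" "j \<le> q" for n j
    using that(2)
  proof (induction j)
    case 0
    then show ?case using assms(13) that(1) by simp
  next
    case (Suc j)
    \<comment> \<open>The coefficient list is indexed from 0, so stage \<open>Suc j\<close> uses
      entry \<open>j\<close>.\<close>
    have "Y n (Suc j) = (\<lambda>x. Y n j x + of_real (k * triple_jump p ! j)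
        * nls_rhs s N (\<lambda>y. (Y n (Suc j) y + Y n j y) / 2) x)"
      using assms(14)[of n "Suc j"] that(1) Suc.prems by simp
    from midpoint_stage_invariants[OF Y_in Y_in this] Suc that(1) show ?case
      by simp
  qed
  \<comment> \<open>Outer induction over time: the last stage \<open>Y n q\<close> is the next value
    \<open>U (Suc n)\<close>.\<close>
  have "l2_norm (U n) = l2_norm (U 0) \<and>
      Im (l2_inner (U n) (dx (U n))) = Im (l2_inner (U 0) (dx (U 0)))" if "n \<le> M" for n
    using that
  proof (induction n)
    case (Suc n)
    then show ?case using assms(15)[of n] Y_inv[of n q] by simp
  qed simp
  then show ?thesis by blast
qed

end
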